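(* Let $m\in\{0,1\}$. Then $$\lim_{X\to+\infty}\frac{\#\{0\le n\le X:\ \mathcal{J}^*_{6}(3^m(8n+1))\equiv 0 \pmod 2\}}{X}=1.$$
   Context: Let $q=e^{2\pi i\tau}$, $\tau$ in the upper half-plane, and $(a;q)_\infty=\prod_{j\ge0}(1-aq^j)$. The Dedekind eta function is $\eta(\tau)=q^{1/24}(q;q)_\infty$. The Hauptmodul $j_6^*$ of the Fricke group $\Gamma_0^*(6)$ is $$j_6^{*}(\tau)=\left(\frac{\eta(\tau)\eta(3\tau)}{\eta(2\tau)\eta(6\tau)}\right)^6+6+2^6\left(\frac{\eta(2\tau)\eta(6\tau)}{\eta(\tau)\eta(3\tau)}\right)^6 = \frac1q+\sum_{n\ge 0}\mathcal{J}^*_6(n)q^n,$$ which defines the integers $\mathcal{J}^*_6(n)$. *)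

theory Defs
  imports "HOL-Analysis.Analysis" "HOL-Computational_Algebra.Formal_Power_Series"
begin

text \<open>The formal power series of (q^k;q^k)_infinity = prod_{j>=1} (1 - q^{kj}).
  Its n-th coefficient only depends on the finite product over j = 1..n (k >= 1).\<close>
definition qpoch_fps :: "nat \<Rightarrow> rat fps" where
  "qpoch_fps k = Abs_fps (\<lambda>n. fps_nth (\<Prod>j\<in>{1..n}. (1 - fps_X ^ (k * j))) n)"

text \<open>P(q) = ((q;q)(q^3;q^3) / ((q^2;q^2)(q^6;q^6)))^6, so that the eta quotient
  (eta(tau)eta(3tau)/(eta(2tau)eta(6tau)))^6 equals q^{-1} P(q).\<close>
definition P6 :: "rat fps" where
  "P6 = (qpoch_fps 1 * qpoch_fps 3) ^ 6 * inverse ((qpoch_fps 2 * qpoch_fps 6) ^ 6)"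

text \<open>j_6^* = q^{-1} (P + 6 q + 64 q^2 / P); hence J_6^*(n) is the coefficient of q^{n+1}
  in P + 6 q + 64 q^2 P^{-1}, for n >= 0.\<close>
definition Jstar6 :: "nat \<Rightarrow> rat" where
  "Jstar6 n = fps_nth (P6 + 6 * fps_X + 64 * fps_X ^ 2 * inverse P6) (n + 1)"

end

theory Submission
  imports Defs "HOL-Library.Z2" "HOL-Computational_Algebra.Formal_Laurent_Series"
    "HOL-Real_Asymp.Real_Asymp"
begin

text \<open>
  Write $f_k = (q^k;q^k)_\infty$ and $\psi_k = f_k^3$, and work modulo 2, where $f_{2k} = f_k^2$.
  Then $P \equiv (\psi_1\psi_3)^{-2}$ and the other two terms of $j_6^*$ vanish, so the relevant
  coefficients are those of $G = (\psi_1\psi_3)^{-1}$ at $4n+1$ (for $m=0$) and $12n+2$ (for $m=1$).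
  By Gauss, $\psi_1 \equiv \sum_s q^{s(s+1)/2}$. Counting the solutions of $x^2+3y^2=8n+4$ in odd
  positive integers modulo 2 gives $\psi_1\psi_3 \equiv \psi_4 + q\psi_{12}$, and with this the
  sections of $G$ can be computed one after the other: both of the above turn out to be $\psi_1$ again.
  Hence the coefficient is odd precisely when $8n+1$ is a square, which happens for
  $O(\sqrt X)$ of the $n \le X$.
\<close>

unbundle no vec_syntax

text \<open>The default simp rules on \<^typ>\<open>bit\<close> rewrite the ring operations to bit operations,
  out of reach of the ring lemmas.\<close>

declare add_bit_eq_xor [simp del] mult_bit_eq_and [simp del] minus_bit_def [simp del]
  uminus_bit_def [simp del] inverse_bit_def [simp del] divide_bit_def [simp del]
  power_bit_unfold [simp del]

subsection \<open>Gauss's triangular number identity\<close>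

text \<open>The difference of the two sums telescopes; the last summand below is the telescoped term.\<close>

lemma shanks_telescope:
  fixes x :: "'a::comm_ring_1"
  defines "B \<equiv> \<lambda>s. \<Prod>k<s. 1 - x ^ (2*k+1)"
  defines "A \<equiv> \<lambda>s n. \<Prod>k\<in>{s..<n}. 1 - x ^ (2*k+2)"
  assumes "j \<le> m"
  shows "(\<Sum>s<j. B s * A s (Suc m) * x ^ (s*(2*m+3)))
       = (1 - x ^ (2*m+1)) * (\<Sum>s<j. B s * A s m * x ^ (s*(2*m+1)))
         + (1 - x ^ (2*j)) * B j * A j m * x ^ (j*(2*m+1))"
  using assms(3)
proof (induction j)
  case (Suc j)
  have A1: "A j (Suc m) = A j m * (1 - x ^ (2*m+2))"
    using Suc.prems by (simp add: A_def)
  have A2: "A j m = (1 - x ^ (2*j+2)) * A (Suc j) m"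
    using Suc.prems unfolding A_def by (subst prod.atLeast_Suc_lessThan) auto
  have B1: "B (Suc j) = B j * (1 - x ^ (2*j+1))"
    by (simp add: B_def)
  define y z w where "y = x ^ (j*(2*m+1))" and "z = x ^ (2*m+1)" and "w = x ^ (2*j)"
  have e: "x ^ (j*(2*m+3)) = y * w" "x ^ (Suc j*(2*m+1)) = y * z" "x ^ (2*j+1) = w * x"
    "x ^ (2*m+2) = z * x" "x ^ (2*j+2) = w * x * x" "x ^ (2 * Suc j) = w * x * x"
    by (simp_all add: y_def z_def w_def algebra_simps flip: power_add)
  have IH: "(\<Sum>s<j. B s * A s (Suc m) * x ^ (s*(2*m+3)))
       = (1 - z) * (\<Sum>s<j. B s * A s m * x ^ (s*(2*m+1))) + (1 - w) * B j * A j m * y"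
    using Suc unfolding y_def z_def w_def by simp
  \<comment> \<open>Both sides equal \<open>B j * A j m * y * (1 - w * z * x)\<close>.\<close>
  have "B j * A j (Suc m) * (y * w) + (1 - w) * B j * A j m * y
      = (1 - z) * (B j * A j m * y) + (1 - w * x * x) * B (Suc j) * A (Suc j) m * (y * z)"
    unfolding A1 A2 B1 e by (simp add: algebra_simps)
  then show ?case
    unfolding sum.lessThan_Suc IH e z_def[symmetric] y_def[symmetric]
    by (simp add: algebra_simps)
qed simp

text \<open>D. Shanks's finite form of Gauss's identity, multiplied through by the odd factors so that
  it holds in any commutative ring.\<close>

lemma shanks_identity:
  fixes x :: "'a::comm_ring_1"
  shows "(\<Prod>k<n. 1 - x ^ (2*k+1)) * (\<Sum>s<2*n. x ^ (s*(s+1) div 2))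
       = (\<Sum>s<n. (\<Prod>k<s. 1 - x ^ (2*k+1)) * (\<Prod>k\<in>{s..<n}. 1 - x ^ (2*k+2)) * x ^ (s*(2*n+1)))"
proof (induction n)
  case (Suc m)
  define B where "B = (\<lambda>s. \<Prod>k<s. 1 - x ^ (2*k+1))"
  define A where "A = (\<lambda>s n. \<Prod>k\<in>{s..<n}. 1 - x ^ (2*k+2))"
  define y z w where "y = x ^ (m*(2*m+1))" and "z = x ^ (2*m+1)" and "w = x ^ (2*m)"
  have e: "x ^ (m*(2*m+3)) = y * w" "x ^ (Suc m*(2*m+1)) = y * z" "x ^ (2*m+2) = z * x" "z = w * x"
    by (simp_all add: y_def z_def w_def algebra_simps flip: power_add)
  have B1: "B (Suc m) = B m * (1 - z)"
    by (simp add: B_def z_def)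
  have t: "2*m*(2*m+1) div 2 = m*(2*m+1)" "(2*m+1)*(2*m+1+1) div 2 = Suc m*(2*m+1)"
    by (metis mult.assoc nonzero_mult_div_cancel_left zero_neq_numeral)
       (metis (no_types, opaque_lifting) Suc_eq_plus1 add_Suc_right mult.assoc mult.commute mult_2
          nonzero_mult_div_cancel_left zero_neq_numeral add_Suc)
  have T: "(\<Sum>s<2*Suc m. x ^ (s*(s+1) div 2)) = (\<Sum>s<2*m. x ^ (s*(s+1) div 2)) + y + y * z"
  proof -
    have "2 * Suc m = Suc (Suc (2*m))" by simp
    then have "(\<Sum>s<2*Suc m. x ^ (s*(s+1) div 2)) = (\<Sum>s<2*m. x ^ (s*(s+1) div 2))
        + x ^ (2*m*(2*m+1) div 2) + x ^ ((2*m+1)*(2*m+1+1) div 2)"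
      by (simp only: sum.lessThan_Suc) (simp only: Suc_eq_plus1)
    then show ?thesis unfolding t e y_def[symmetric] .
  qed
  have A1: "A m (Suc m) = 1 - z * x" "A m m = 1"
    by (simp_all add: A_def e[symmetric])
  have IH: "B m * (\<Sum>s<2*m. x ^ (s*(s+1) div 2)) = (\<Sum>s<m. B s * A s m * x ^ (s*(2*m+1)))"
    using Suc unfolding A_def B_def .
  have tel: "(\<Sum>s<m. B s * A s (Suc m) * x ^ (s*(2*m+3)))
      = (1 - z) * (\<Sum>s<m. B s * A s m * x ^ (s*(2*m+1))) + (1 - w) * B m * A m m * y"
    using shanks_telescope[of m m x] unfolding A_def B_def y_def z_def w_def by blast
  have "(\<Sum>s<Suc m. B s * A s (Suc m) * x ^ (s*(2*m+3)))
      = (1 - z) * (B m * (\<Sum>s<2*m. x ^ (s*(s+1) div 2))) + (1 - w) * B m * y + B m * (1 - z * x) * (y * w)"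
    unfolding sum.lessThan_Suc tel A1 e(1) IH by simp
  \<comment> \<open>Since \<open>w * x = z\<close>, the last two terms add up to
    \<open>B m * y * (1 - z * z)\<close>. This is \<open>B (Suc m) * (y + y * z)\<close>, the
    contribution of the two new triangular exponents.\<close>
  also have "\<dots> = B (Suc m) * (\<Sum>s<2*Suc m. x ^ (s*(s+1) div 2))"
    unfolding B1 T e(4) by (simp add: algebra_simps)
  finally have main: "B (Suc m) * (\<Sum>s<2*Suc m. x ^ (s*(s+1) div 2))
      = (\<Sum>s<Suc m. B s * A s (Suc m) * x ^ (s*(2*m+3)))" ..
  have n: "2 * Suc m + 1 = 2 * m + 3" by simp
  show ?case
    unfolding n using main unfolding A_def B_def .
qed simp

section \<open>Euler products as formal power series\<close>

text \<open>The product of \<open>qpoch_fps\<close> over an arbitrary commutative ring, so that it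
  is available over the rationals and over \<open>bit\<close> alike.\<close>

definition euler_fps :: "nat \<Rightarrow> 'a::comm_ring_1 fps" where
  "euler_fps k = Abs_fps (\<lambda>n. fps_nth (\<Prod>j\<in>{1..n}. (1 - fps_X ^ (k * j))) n)"

text \<open>A factor with \<open>j > n\<close> differs from 1 only in degree
  \<open>k * j > n\<close>, so it leaves coefficient \<open>n\<close> unchanged.\<close>

lemma euler_fps_nth:
  assumes "k > 0" "n \<le> N"
  shows "(euler_fps k :: 'a::comm_ring_1 fps) $ n = (\<Prod>j\<in>{1..N}. (1 - fps_X ^ (k * j))) $ n"
  using assms(2)
proof (induction N rule: dec_induct)
  case (step M)
  let ?P = "\<Prod>j\<in>{1..M}. (1 - fps_X ^ (k * j)) :: 'a fps"
  have "Suc M \<le> k * Suc M" using mult_le_mono1[of 1 k "Suc M"] assms(1) by simp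
  then have n: "n < k * Suc M" using step.hyps(1) by (metis le_imp_less_Suc order_less_le_trans)
  have "(\<Prod>j\<in>{1..Suc M}. (1 - fps_X ^ (k * j))) = ?P - fps_X ^ (k * Suc M) * ?P"
    by (subst prod.nat_ivl_Suc') (simp_all only: le_add1 Suc_eq_plus1 add.commute left_diff_distrib mult_1_left)
  then show ?case
    using n step.IH by (simp only: fps_sub_nth fps_X_power_mult_nth if_True diff_zero)
qed (simp add: euler_fps_def)

lemma euler_fps_nth_0 [simp]: "euler_fps k $ 0 = 1"
  by (simp add: euler_fps_def)

text \<open>Substituting \<open>fps_X ^ k\<close> commutes with finite products. Coefficient
  \<open>n\<close> of the result needs only coefficient \<open>n div k\<close> of the original
  product, for which the cut-off at \<open>n\<close> is late enough.\<close>

lemma euler_fps_compose: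
  assumes "k > 0"
  shows "euler_fps k = (euler_fps 1 oo fps_X ^ k :: 'a::idom fps)"
proof (rule fps_ext)
  fix n
  have X: "(fps_X ^ k :: 'a fps) $ 0 = 0" using assms by simp
  have "euler_fps k $ n = ((\<Prod>j\<in>{1..n}. (1 - fps_X ^ (1 * j))) oo (fps_X ^ k :: 'a fps)) $ n"
    by (simp only: euler_fps_def fps_nth_Abs_fps fps_compose_prod_distrib[OF X] fps_compose_sub_distrib
      fps_compose_power[OF X, symmetric] power_mult fps_X_fps_compose_startby0[OF X] fps_compose_1 power_one_right)
  also have "\<dots> = (euler_fps 1 oo fps_X ^ k) $ n"
    unfolding fps_nth_compose_X_power
    using assms by (simp add: euler_fps_nth[of 1 _ n] del: One_nat_def)
  finally show "euler_fps k $ n = (euler_fps 1 oo fps_X ^ k :: 'a fps) $ n" .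
qed

lemma fps_mult_nth_cong:
  assumes "\<And>i. i \<le> n \<Longrightarrow> F $ i = F' $ i" "\<And>i. i \<le> n \<Longrightarrow> G $ i = G' $ i"
  shows "(F * G) $ n = (F' * G') $ n"
  unfolding fps_mult_nth using assms by (intro sum.cong) auto

lemma two_triangle: "2 * (s * (s + 1) div 2) = s * (s + 1)" for s :: nat
  by (simp add: dvd_mult_div_cancel)

lemma triangle_strict_mono: "strict_mono (\<lambda>s::nat. s * (s + 1) div 2)"
proof (rule strict_monoI)
  fix s t :: nat
  assume "s < t"
  then have "s * (s + 1) < t * (t + 1)"
    by (intro mult_strict_mono) auto
  then show "s * (s + 1) div 2 < t * (t + 1) div 2"
    using two_triangle[of s] two_triangle[of t] by linarith
qed

lemma triangle_sum_nth:
  assumes "i < m"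
  shows "(\<Sum>s<m. fps_X ^ (s * (s + 1) div 2) :: 'a::comm_ring_1 fps) $ i
       = of_bool (\<exists>s. s * (s + 1) div 2 = i)"
proof (cases "\<exists>s. s * (s + 1) div 2 = i")
  case True
  then obtain t where t: "t * (t + 1) div 2 = i" by blast
  have "t \<le> t * (t + 1) div 2"
    using strict_mono_imp_increasing[OF triangle_strict_mono] .
  then have "t < m" using t assms by simp
  have "i = s * (s + 1) div 2 \<longleftrightarrow> s = t" for s
    using strict_mono_eq[OF triangle_strict_mono, of s t] t by auto
  then have "(\<Sum>s<m. fps_X ^ (s * (s + 1) div 2) :: 'a fps) $ i = (\<Sum>s<m. if s = t then 1 else 0)"
    by (simp only: fps_sum_nth fps_X_power_nth)
  then show ?thesis using \<open>t < m\<close> True by simp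
next
  case False
  then have "i \<noteq> s * (s + 1) div 2" for s by metis
  then have "(\<Sum>s<m. fps_X ^ (s * (s + 1) div 2) :: 'a fps) $ i = 0"
    by (simp only: fps_sum_nth fps_X_power_nth if_False sum.neutral_const)
  then show ?thesis using False by simp
qed

lemma prod_lessThan_double:
  fixes f :: "nat \<Rightarrow> 'a::comm_monoid_mult"
  shows "(\<Prod>k<2*n. f k) = (\<Prod>k<n. f (2*k+1)) * (\<Prod>k<n. f (2*k))"
  by (induction n) (simp_all add: mult_ac)

text \<open>Gauss's identity without denominators. For \<open>n > N\<close> the summands of
  \<open>shanks_identity\<close> with \<open>s > 0\<close> start beyond degree \<open>N\<close>, so
  up to there the odd factors \<open>B n\<close> times the triangular sum give the even product
  \<open>A 0\<close>. Multiplication by \<open>A 0\<close> completes \<open>B n\<close> to the full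
  Euler product.\<close>

lemma euler_fps_gauss:
  "euler_fps 1 * Abs_fps (\<lambda>n. of_bool (\<exists>s. s * (s + 1) div 2 = n)) = (euler_fps 2 :: 'a::comm_ring_1 fps)\<^sup>2"
proof (rule fps_ext)
  fix N
  define n where "n = Suc N"
  define A :: "nat \<Rightarrow> 'a fps" where "A = (\<lambda>s. \<Prod>k\<in>{s..<n}. 1 - fps_X ^ (2*k+2))"
  define B :: "nat \<Rightarrow> 'a fps" where "B = (\<lambda>s. \<Prod>k<s. 1 - fps_X ^ (2*k+1))"
  define T :: "'a fps" where "T = (\<Sum>s<2*n. fps_X ^ (s * (s + 1) div 2))"
  have E1: "euler_fps 1 $ i = (A 0 * B n) $ i" if "i \<le> N" for i
  proof -
    have "euler_fps 1 $ i = (\<Prod>j\<in>{1..2*n}. (1 - fps_X ^ (1 * j)) :: 'a fps) $ i"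
      using that by (intro euler_fps_nth) (auto simp: n_def)
    also have "(\<Prod>j\<in>{1..2*n}. (1 - fps_X ^ (1 * j)) :: 'a fps) = (\<Prod>k<2*n. 1 - fps_X ^ Suc k)"
      by (simp add: prod.atLeast1_atMost_eq)
    also have "\<dots> = A 0 * B n"
      by (simp only: prod_lessThan_double A_def B_def atLeast0LessThan Suc_eq_plus1 add.assoc one_add_one)
    finally show ?thesis .
  qed
  have E2: "euler_fps 2 $ i = A 0 $ i" if "i \<le> N" for i
  proof -
    have "euler_fps 2 $ i = (\<Prod>j\<in>{1..n}. (1 - fps_X ^ (2 * j)) :: 'a fps) $ i"
      using that by (intro euler_fps_nth) (auto simp: n_def)
    also have "(\<Prod>j\<in>{1..n}. (1 - fps_X ^ (2 * j)) :: 'a fps) = A 0"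
      unfolding A_def One_nat_def prod.atLeast1_atMost_eq atLeast0LessThan by simp
    finally show ?thesis .
  qed
  have R: "(B n * T) $ i = A 0 $ i" if "i \<le> N" for i
  proof -
    have "(B n * T) $ i = (\<Sum>s<n. (B s * A s * fps_X ^ (s*(2*n+1))) $ i)"
      unfolding A_def B_def T_def shanks_identity fps_sum_nth ..
    also have "\<dots> = A 0 $ i + (\<Sum>s<N. (B (Suc s) * A (Suc s) * fps_X ^ (Suc s*(2*n+1))) $ i)"
      unfolding n_def sum.lessThan_Suc_shift by (simp add: B_def)
    also have "(\<Sum>s<N. (B (Suc s) * A (Suc s) * fps_X ^ (Suc s*(2*n+1))) $ i) = 0"
    proof (intro sum.neutral ballI)
      fix s
      have "2 * n + 1 \<le> Suc s * (2*n+1)" by simp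
      moreover have "i < 2 * n + 1" using that by (simp add: n_def)
      ultimately have "i < Suc s * (2*n+1)" by (rule order.strict_trans2[rotated])
      then show "(B (Suc s) * A (Suc s) * fps_X ^ (Suc s*(2*n+1))) $ i = 0"
        by (simp only: fps_X_power_mult_right_nth if_True)
    qed
    finally show ?thesis by simp
  qed
  have T: "T $ i = of_bool (\<exists>s. s * (s + 1) div 2 = i)" if "i \<le> N" for i
    unfolding T_def using that by (intro triangle_sum_nth) (simp add: n_def)
  have "(euler_fps 1 * Abs_fps (\<lambda>n. of_bool (\<exists>s. s * (s + 1) div 2 = n))) $ N = ((A 0 * B n) * T) $ N"
    by (intro fps_mult_nth_cong) (simp_all only: E1 T fps_nth_Abs_fps)
  also have "\<dots> = (A 0 * (B n * T)) $ N"
    by (simp only: mult.assoc)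
  also have "\<dots> = (euler_fps 2 * euler_fps 2) $ N"
    by (intro fps_mult_nth_cong) (simp_all add: E2 R)
  finally show "(euler_fps 1 * Abs_fps (\<lambda>n. of_bool (\<exists>s. s * (s + 1) div 2 = n))) $ N
      = ((euler_fps 2)\<^sup>2 :: 'a fps) $ N"
    by (simp only: power2_eq_square)
qed

section \<open>Squaring in characteristic 2 and the cube of the Euler product\<close>

lemma bit_add_self [simp]: "b + b = (0::bit)"
  by (cases b) simp_all

lemma bit_mult_self [simp]: "b * b = (b::bit)"
  by (cases b) simp_all

text \<open>In the Cauchy product the terms at \<open>i\<close> and \<open>n - i\<close> cancel in
  pairs. Only \<open>2 * i = n\<close> is left, where \<open>b * b = b\<close> holds in
  \<open>bit\<close>.\<close>

lemma fps_bit_power2: "F\<^sup>2 = F oo fps_X ^ 2" for F :: "bit fps"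
proof (rule fps_ext)
  fix n
  define I :: "nat set" where "I = {i. i \<le> n \<and> 2 * i \<noteq> n}"
  have 0: "(\<Sum>i\<in>I. F $ i * F $ (n - i)) = 0"
    by (rule sum_involution_eq_0[where h = "\<lambda>i. n - i"]) (auto simp: I_def mult.commute)
  have "(F\<^sup>2) $ n = (\<Sum>i\<in>{0..n}. F $ i * F $ (n - i))"
    by (simp add: power2_eq_square fps_mult_nth)
  also have "\<dots> = (\<Sum>i\<in>{i::nat. 2 * i = n}. F $ i * F $ (n - i)) + (\<Sum>i\<in>I. F $ i * F $ (n - i))"
  proof -
    have "{0..n} = {i. 2 * i = n} \<union> I" "finite {i::nat. 2 * i = n}" "finite I"
      by (auto simp: I_def intro!: finite_subset[of "{i. 2 * i = n}" "{0..n}"])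
    moreover have "{i. 2 * i = n} \<inter> I = {}" by (auto simp: I_def)
    ultimately show ?thesis by (simp only: sum.union_disjoint)
  qed
  also have "\<dots> = (F oo fps_X ^ 2) $ n"
  proof (cases "even n")
    case True
    then obtain k where k: "n = 2 * k" by blast
    have "{i::nat. 2 * i = n} = {k}" using k by auto
    then show ?thesis using 0 k by (simp add: fps_nth_compose_X_power)
  next
    case False
    then have "{i::nat. 2 * i = n} = {}" by auto
    then show ?thesis using 0 False by (simp add: fps_nth_compose_X_power)
  qed
  finally show "(F\<^sup>2) $ n = (F oo fps_X ^ 2) $ n" .
qed

text \<open>The exponents are the triangular numbers, as \<open>8 * (s * (s + 1) div 2) + 1\<close>
  is the square of \<open>2 * s + 1\<close>. The form with squares is the one that the count of
  solutions of \<open>x^2 + 3 * y^2 = 8 * n + 4\<close> and the density estimate use.\<close>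

definition psi :: "bit fps" where
  "psi = Abs_fps (\<lambda>n. of_bool (\<exists>x. x\<^sup>2 = 8 * n + 1))"

lemma triangle_iff_square: "(\<exists>s. s * (s + 1) div 2 = n) \<longleftrightarrow> (\<exists>x. x\<^sup>2 = 8 * n + 1)" for n :: nat
proof
  assume "\<exists>s. s * (s + 1) div 2 = n"
  then obtain s where "s * (s + 1) = 2 * n" using two_triangle by metis
  then have "(2 * s + 1)\<^sup>2 = 8 * n + 1"
    by (simp add: power2_eq_square algebra_simps)
  then show "\<exists>x. x\<^sup>2 = 8 * n + 1" by blast
next
  assume "\<exists>x. x\<^sup>2 = 8 * n + 1"
  then obtain x where x: "x\<^sup>2 = 8 * n + 1" by blast
  then have "odd (x\<^sup>2)" by simp
  then have "odd x" by simp
  then obtain s where s: "x = 2 * s + 1" by (elim oddE)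
  have "s * (s + 1) = 2 * n" using x unfolding s by (simp add: power2_eq_square algebra_simps)
  then show "\<exists>s. s * (s + 1) div 2 = n" by (metis nonzero_mult_div_cancel_left zero_neq_numeral)
qed

text \<open>Modulo 2, \<open>euler_fps 2\<close> is the square of \<open>euler_fps 1\<close>, so
  Gauss's identity reads \<open>?E * psi = ?E ^ 4\<close>, and \<open>?E\<close> cancels.\<close>

lemma euler_fps_bit_cube: "(euler_fps 1 :: bit fps) ^ 3 = psi"
proof -
  let ?E = "euler_fps 1 :: bit fps"
  have "?E * psi = (euler_fps 2)\<^sup>2"
    using euler_fps_gauss[where ?'a = bit] unfolding psi_def triangle_iff_square .
  also have "euler_fps 2 = ?E\<^sup>2"
    unfolding fps_bit_power2[of ?E] by (rule euler_fps_compose) simp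
  also have "(?E\<^sup>2)\<^sup>2 = ?E * ?E ^ 3"
    by (simp add: numeral_eq_Suc)
  finally have "?E * psi = ?E * ?E ^ 3" .
  moreover have "?E \<noteq> 0" using euler_fps_nth_0[of 1] by (metis fps_zero_nth zero_neq_one)
  ultimately show ?thesis by simp
qed

subsection \<open>The 2-dissection of $\psi_1\psi_3$ modulo 2\<close>

text \<open>If the sign of $y$ is chosen such that $x \equiv y$ modulo 4, then $u = (x+3y)/4$ and
  $w = (x-y)/4$ are integers with $x = u+3w$, $y = u-w$ and $x^2+3y^2 = 4(u^2+3w^2)$. The map below is
  $w \mapsto -w$ followed by taking absolute values of the resulting $x$ and $y$. Its fixed points
  have $w = 0$ or $u = 0$, that is, $x = y$ or $x = 3y$.\<close>

definition eisenstein_flip :: "int \<times> int \<Rightarrow> int \<times> int" where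
  "eisenstein_flip = (\<lambda>(x, y). if 4 dvd x - y then (\<bar>3 * y - x\<bar> div 2, (x + y) div 2)
     else ((x + 3 * y) div 2, \<bar>x - y\<bar> div 2))"

lemma eisenstein_flip_minus: "eisenstein_flip (x, x + 4 * t) = (\<bar>x + 6 * t\<bar>, x + 2 * t)"
proof -
  have "\<bar>3 * (x + 4 * t) - x\<bar> = 2 * \<bar>x + 6 * t\<bar>" "x + (x + 4 * t) = 2 * (x + 2 * t)"
    by (simp_all add: abs_if)
  then show ?thesis by (simp add: eisenstein_flip_def)
qed

text \<open>Here \<open>- y\<close> is the choice congruent to \<open>x\<close> modulo 4, with
  \<open>w = t\<close> and \<open>u = x - 3 * t\<close>. For positive pairs the new first entry
  \<open>x - 6 * t\<close> is negative, so its absolute value is \<open>6 * t - x\<close>.\<close>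

lemma eisenstein_flip_plus:
  assumes "odd x"
  shows "eisenstein_flip (x, 4 * t - x) = (6 * t - x, \<bar>x - 2 * t\<bar>)"
proof -
  have "\<not> 4 dvd x - (4 * t - x)" using assms by presburger
  moreover have "x + 3 * (4 * t - x) = 2 * (6 * t - x)" "\<bar>x - (4 * t - x)\<bar> = 2 * \<bar>x - 2 * t\<bar>"
    by (simp_all add: abs_if)
  ultimately show ?thesis by (simp add: eisenstein_flip_def)
qed

lemma odd_pair_cases:
  fixes x y :: int
  assumes "odd x" "odd y"
  obtains t where "y = x + 4 * t" | t where "y = 4 * t - x"
proof -
  have "4 dvd y - x \<or> 4 dvd y + x" using assms by presburger
  then show thesis
  proof
    assume "4 dvd y - x"
    then obtain t where "y - x = 4 * t" by blast
    then show thesis using that(1)[of t] by simp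
  next
    assume "4 dvd y + x"
    then obtain t where "y + x = 4 * t" by blast
    then show thesis using that(2)[of t] by simp
  qed
qed

section \<open>Parity of the number of odd solutions of \<open>x^2 + 3 * y^2 = N\<close>\<close>

definition odd_reps :: "int \<Rightarrow> (int \<times> int) set" where
  "odd_reps N = {(x, y). 0 < x \<and> 0 < y \<and> odd x \<and> odd y \<and> x\<^sup>2 + 3 * y\<^sup>2 = N}"

lemma eisenstein_flip_odd_reps:
  assumes "p \<in> odd_reps N"
  shows "eisenstein_flip p \<in> odd_reps N" "eisenstein_flip (eisenstein_flip p) = p"
    "eisenstein_flip p = p \<longleftrightarrow> fst p = snd p \<or> fst p = 3 * snd p"
proof -
  obtain x y where p: "p = (x, y)" by (cases p)
  have xy: "0 < x" "0 < y" "odd x" "odd y" "x\<^sup>2 + 3 * y\<^sup>2 = N"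
    using assms by (auto simp: p odd_reps_def)
  have "eisenstein_flip p \<in> odd_reps N \<and> eisenstein_flip (eisenstein_flip p) = p \<and>
     (eisenstein_flip p = p \<longleftrightarrow> fst p = snd p \<or> fst p = 3 * snd p)"
    using xy(3,4)
  proof (cases rule: odd_pair_cases)
    case (1 t)
    have g: "eisenstein_flip p = (\<bar>x + 6 * t\<bar>, x + 2 * t)"
      by (simp add: p 1 eisenstein_flip_minus)
    have o: "odd (x + 6 * t)" "odd (x + 2 * t)" using xy(3) by simp_all
    \<comment> \<open>This number is \<open>(3 * y - x) / 2\<close>. Being odd, it has positive
      absolute value, and \<open>x = 3 * y\<close> cannot occur in this case.\<close>
    then have nz: "x + 6 * t \<noteq> 0" by (metis even_zero)
    moreover have "0 < x + 2 * t" using xy 1 by simp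
    moreover have "(x + 6 * t)\<^sup>2 + 3 * (x + 2 * t)\<^sup>2 = N"
      using xy(5) unfolding 1 by (simp add: power2_eq_square algebra_simps)
    ultimately have "eisenstein_flip p \<in> odd_reps N"
      using o by (auto simp: g odd_reps_def)
    moreover have "eisenstein_flip (eisenstein_flip p) = p"
    \<comment> \<open>The sign decides whether the entries of the new pair are again congruent
      modulo 4 or the pair belongs to the other branch of the flip.\<close>
    proof (cases "x + 6 * t > 0")
      case True
      have "eisenstein_flip (x + 6 * t, x + 2 * t) = (\<bar>x\<bar>, x + 4 * t)"
        using eisenstein_flip_minus[of "x + 6 * t" "- t"] by (simp add: algebra_simps)
      then show ?thesis using True xy(1) unfolding g by (simp add: p 1)
    next
      case False
      have "eisenstein_flip (- (x + 6 * t), x + 2 * t) = (x, \<bar>- x - 4 * t\<bar>)"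
        using eisenstein_flip_plus[of "- (x + 6 * t)" "- t"] o(1) by (simp add: algebra_simps)
      then show ?thesis using False xy(2) unfolding g by (simp add: p 1)
    qed
    moreover have "eisenstein_flip p = p \<longleftrightarrow> x = y \<or> x = 3 * y"
      unfolding g unfolding p prod.inject using xy(1,2) 1 nz by arith
    ultimately show ?thesis by (simp add: p)
  next
    case (2 t)
    have g: "eisenstein_flip p = (6 * t - x, \<bar>x - 2 * t\<bar>)"
      using xy(3) by (simp add: p 2 eisenstein_flip_plus)
    have o: "odd (6 * t - x)" "odd (x - 2 * t)" using xy(3) by simp_all
    \<comment> \<open>This number is \<open>(x - y) / 2\<close>, so \<open>x = y\<close> is excluded
      here and fixed points have \<open>x = 3 * y\<close>.\<close>
    then have nz: "x - 2 * t \<noteq> 0" by (metis even_zero)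
    moreover have "0 < 6 * t - x" using xy 2 by simp
    moreover have "(6 * t - x)\<^sup>2 + 3 * (x - 2 * t)\<^sup>2 = N"
      using xy(5) unfolding 2 by (simp add: power2_eq_square algebra_simps)
    ultimately have "eisenstein_flip p \<in> odd_reps N"
      using o by (auto simp: g odd_reps_def)
    moreover have "eisenstein_flip (eisenstein_flip p) = p"
    proof (cases "x - 2 * t > 0")
      case True
      have "eisenstein_flip (6 * t - x, x - 2 * t) = (x, \<bar>4 * t - x\<bar>)"
        using eisenstein_flip_plus[of "6 * t - x" t] o(1) by (simp add: algebra_simps)
      then show ?thesis using True xy(2) unfolding g by (simp add: p 2)
    next
      case False
      have "eisenstein_flip (6 * t - x, - (x - 2 * t)) = (\<bar>x\<bar>, 4 * t - x)"
        using eisenstein_flip_minus[of "6 * t - x" "- t"] by (simp add: algebra_simps)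
      then show ?thesis using False xy(1) unfolding g by (simp add: p 2)
    qed
    moreover have "eisenstein_flip p = p \<longleftrightarrow> x = y \<or> x = 3 * y"
      unfolding g unfolding p prod.inject using xy(1,2) 2 nz by arith
    ultimately show ?thesis by (simp add: p)
  qed
  then show "eisenstein_flip p \<in> odd_reps N" "eisenstein_flip (eisenstein_flip p) = p"
    "eisenstein_flip p = p \<longleftrightarrow> fst p = snd p \<or> fst p = 3 * snd p" by blast+
qed

lemma finite_odd_reps: "finite (odd_reps N)"
proof (rule finite_subset)
  show "odd_reps N \<subseteq> {0..N} \<times> {0..N}"
  proof
    fix p assume p: "p \<in> odd_reps N"
    obtain x y where [simp]: "p = (x, y)" by (cases p)
    have "0 < x" "0 < y" "x\<^sup>2 + 3 * y\<^sup>2 = N" using p by (auto simp: odd_reps_def)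
    moreover from this have "x \<le> x\<^sup>2" "y \<le> y\<^sup>2" by (simp_all add: self_le_power)
    moreover from this have "x\<^sup>2 \<ge> 0" "y\<^sup>2 \<ge> 0" by simp_all
    ultimately show "p \<in> {0..N} \<times> {0..N}" by simp
  qed
qed simp

lemma sum_one_at_most_singleton:
  assumes "\<And>x y. x \<in> A \<Longrightarrow> y \<in> A \<Longrightarrow> x = y"
  shows "(\<Sum>x\<in>A. 1) = (of_bool (A \<noteq> {}) :: 'a::semiring_1)"
proof (cases "A = {}")
  case False
  then obtain a where "a \<in> A" by blast
  then have "A = {a}" using assms by blast
  then show ?thesis by simp
qed simp

text \<open>The flip pairs off all solutions except those with \<open>x = y\<close> or
  \<open>x = 3 * y\<close>. For these the equation becomes \<open>4 * y^2 = 4 * M\<close> or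
  \<open>12 * y^2 = 4 * M\<close>, each with at most one positive solution.\<close>

lemma sum_odd_reps:
  "(\<Sum>p\<in>odd_reps (4 * M). 1 :: bit)
     = of_bool (\<exists>x>0. odd x \<and> x\<^sup>2 = M) + of_bool (\<exists>y>0. odd y \<and> 3 * y\<^sup>2 = M)"
proof -
  let ?S = "odd_reps (4 * M)"
  define D1 where "D1 = {p \<in> ?S. fst p = snd p}"
  define D2 where "D2 = {p \<in> ?S. fst p = 3 * snd p}"
  define D3 where "D3 = {p \<in> ?S. eisenstein_flip p \<noteq> p}"
  have S: "?S = (D1 \<union> D2) \<union> D3"
    using eisenstein_flip_odd_reps(3) unfolding D1_def D2_def D3_def by blast
  have fin: "finite D1" "finite D2" "finite D3"
    using finite_odd_reps unfolding D1_def D2_def D3_def by simp_all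
  have dis: "D1 \<inter> D2 = {}" "(D1 \<union> D2) \<inter> D3 = {}"
    using eisenstein_flip_odd_reps(3) by (auto simp: D1_def D2_def D3_def odd_reps_def)
  have "(\<Sum>p\<in>D3. 1 :: bit) = 0"
  proof (rule sum_involution_eq_0[where h = eisenstein_flip])
    fix p assume p: "p \<in> D3"
    then have "p \<in> ?S" "eisenstein_flip p \<noteq> p" by (simp_all add: D3_def)
    then show "eisenstein_flip p \<in> D3" "eisenstein_flip (eisenstein_flip p) = p" "eisenstein_flip p \<noteq> p"
      using eisenstein_flip_odd_reps(1,2)[of p "4 * M"] by (simp_all add: D3_def)
  qed simp
  moreover have "(\<Sum>p\<in>?S. 1 :: bit) = (\<Sum>p\<in>D1. 1) + (\<Sum>p\<in>D2. 1) + (\<Sum>p\<in>D3. 1)"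
    unfolding S using fin dis by (simp only: sum.union_disjoint finite_UnI)
  moreover have "(\<Sum>p\<in>D1. 1 :: bit) = of_bool (D1 \<noteq> {})"
    by (rule sum_one_at_most_singleton) (auto simp: D1_def odd_reps_def power2_eq_iff)
  moreover have "(\<Sum>p\<in>D2. 1 :: bit) = of_bool (D2 \<noteq> {})"
    by (rule sum_one_at_most_singleton) (auto simp: D2_def odd_reps_def power2_eq_iff power_mult_distrib)
  moreover have "D1 \<noteq> {} \<longleftrightarrow> (\<exists>x>0. odd x \<and> x\<^sup>2 = M)"
    by (auto simp: D1_def odd_reps_def)
  moreover have "D2 \<noteq> {} \<longleftrightarrow> (\<exists>y>0. odd y \<and> 3 * y\<^sup>2 = M)"
  proof
    assume "D2 \<noteq> {}"
    then show "\<exists>y>0. odd y \<and> 3 * y\<^sup>2 = M"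
      by (auto simp: D2_def odd_reps_def power_mult_distrib)
  next
    assume "\<exists>y>0. odd y \<and> 3 * y\<^sup>2 = M"
    then obtain y where "y > 0" "odd y" "3 * y\<^sup>2 = M" by blast
    then have "(3 * y, y) \<in> D2" by (simp add: D2_def odd_reps_def power_mult_distrib)
    then show "D2 \<noteq> {}" by blast
  qed
  ultimately show ?thesis by simp
qed

lemma odd_square_iff:
  "(\<exists>x. x\<^sup>2 = 8 * n + 1) \<longleftrightarrow> (\<exists>x>0. odd x \<and> x\<^sup>2 = 8 * int n + 1)"
proof
  assume "\<exists>x. x\<^sup>2 = 8 * n + 1"
  then obtain x where x: "x\<^sup>2 = 8 * n + 1" by blast
  then have "x \<noteq> 0" "odd (x\<^sup>2)" by (auto intro: ccontr)
  moreover have "(int x)\<^sup>2 = 8 * int n + 1" using arg_cong[OF x, of int] by simp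
  ultimately show "\<exists>x>0. odd x \<and> x\<^sup>2 = 8 * int n + 1"
    by (intro exI[of _ "int x"]) auto
next
  assume "\<exists>x>0. odd x \<and> x\<^sup>2 = 8 * int n + 1"
  then obtain x where "x > 0" "x\<^sup>2 = 8 * int n + 1" by blast
  then have "int ((nat x)\<^sup>2) = int (8 * n + 1)" by simp
  then show "\<exists>x. x\<^sup>2 = 8 * n + 1" by (simp only: of_nat_eq_iff) blast
qed

lemma odd_square_mod_8:
  fixes x :: int
  assumes "odd x"
  obtains k where "x\<^sup>2 = 8 * int k + 1"
proof -
  obtain a where a: "x = 2 * a + 1" using assms by (elim oddE)
  have "even (a * (a + 1))" by simp
  then obtain j where "a * (a + 1) = 2 * j" by blast
  then have "x\<^sup>2 = 8 * j + 1" unfolding a by (simp add: power2_eq_square algebra_simps)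
  moreover from this have "j \<ge> 0" using zero_le_power2[of x] by linarith
  ultimately show thesis using that[of "nat j"] by simp
qed

text \<open>With \<open>x^2 = 8 * i + 1\<close> and \<open>y^2 = 8 * j + 1\<close> the equation
  becomes \<open>i + 3 * j = n\<close>, so the solutions index exactly the nonzero terms of
  coefficient \<open>n\<close> in \<open>psi * (psi oo fps_X ^ 3)\<close>.\<close>

lemma bij_betw_odd_reps:
  "bij_betw (\<lambda>(x, y). nat (x\<^sup>2 div 8)) (odd_reps (4 * (2 * int n + 1)))
     {i. i \<le> n \<and> (\<exists>x. x\<^sup>2 = 8 * i + 1) \<and> 3 dvd n - i \<and> (\<exists>y. y\<^sup>2 = 8 * ((n - i) div 3) + 1)}"
  (is "bij_betw ?f ?S ?I")
proof (rule bij_betw_imageI)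
  have rep: "\<exists>i j. x\<^sup>2 = 8 * int i + 1 \<and> y\<^sup>2 = 8 * int j + 1 \<and> n = i + 3 * j \<and> ?f (x, y) = i"
    if "(x, y) \<in> ?S" for x y
  proof -
    have xy: "odd x" "odd y" "x\<^sup>2 + 3 * y\<^sup>2 = 4 * (2 * int n + 1)"
      using that by (auto simp: odd_reps_def)
    obtain i where i: "x\<^sup>2 = 8 * int i + 1" using xy(1) by (rule odd_square_mod_8)
    obtain j where j: "y\<^sup>2 = 8 * int j + 1" using xy(2) by (rule odd_square_mod_8)
    have "int n = int (i + 3 * j)" using xy(3) i j by simp
    then have "n = i + 3 * j" by (simp only: of_nat_eq_iff)
    moreover have "?f (x, y) = i" using i by simp
    ultimately show ?thesis using i j by blast
  qed
  show "inj_on ?f ?S"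
  proof (rule inj_onI)
    fix p q assume pq: "p \<in> ?S" "q \<in> ?S" "?f p = ?f q"
    obtain x y where p: "p = (x, y)" by (cases p)
    obtain u v where q: "q = (u, v)" by (cases q)
    have "x\<^sup>2 = u\<^sup>2" "y\<^sup>2 = v\<^sup>2"
      using rep[of x y] rep[of u v] pq unfolding p q by (metis add_left_cancel mult_cancel1 zero_neq_numeral)+
    then show "p = q" using pq(1,2) by (auto simp: p q odd_reps_def power2_eq_iff)
  qed
  show "?f ` ?S = ?I"
  proof (intro equalityI subsetI)
    fix i assume "i \<in> ?f ` ?S"
    then obtain x y where xy: "(x, y) \<in> ?S" "?f (x, y) = i" by auto
    then obtain j where j: "x\<^sup>2 = 8 * int i + 1" "y\<^sup>2 = 8 * int j + 1" "n = i + 3 * j"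
      using rep[OF xy(1)] by metis
    have "\<exists>x. x\<^sup>2 = 8 * i + 1" "\<exists>y. y\<^sup>2 = 8 * j + 1"
      using xy(1) j(1,2) unfolding odd_square_iff by (auto simp: odd_reps_def)
    then show "i \<in> ?I" using j(3) by simp
  next
    fix i assume i: "i \<in> ?I"
    then obtain j where j: "n - i = 3 * j" by blast
    have "\<exists>x. x\<^sup>2 = 8 * i + 1" "\<exists>y. y\<^sup>2 = 8 * j + 1" using i j by auto
    then obtain x y where xy: "x > 0" "odd x" "x\<^sup>2 = 8 * int i + 1" "y > 0" "odd y" "y\<^sup>2 = 8 * int j + 1"
      unfolding odd_square_iff by blast
    have "n = i + 3 * j" using i j by auto
    then have "(x, y) \<in> ?S" using xy by (simp add: odd_reps_def)
    moreover have "?f (x, y) = i" using xy(3) by simp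
    ultimately show "i \<in> ?f ` ?S" by force
  qed
qed

text \<open>The right-hand side is the first indicator in \<open>sum_odd_reps\<close> for
  \<open>M = 2 * n + 1\<close>. An odd square is 1 modulo 8, which forces
  \<open>4 dvd n\<close>.\<close>

lemma psi_nth_quarter:
  "(psi oo fps_X ^ 4) $ n = of_bool (\<exists>x>0. odd x \<and> x\<^sup>2 = 2 * int n + 1)"
proof (cases "4 dvd n")
  case True
  then obtain k where "n = 4 * k" by blast
  then show ?thesis
    using odd_square_iff[of k] by (simp add: fps_nth_compose_X_power psi_def)
next
  case False
  have "x\<^sup>2 \<noteq> 2 * int n + 1" if ox: "odd x" for x
  proof
    assume x: "x\<^sup>2 = 2 * int n + 1"
    obtain k where "x\<^sup>2 = 8 * int k + 1" using ox by (rule odd_square_mod_8)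
    then have "n = 4 * k" using x by linarith
    then show False using False by simp
  qed
  then show ?thesis using False by (auto simp: fps_nth_compose_X_power)
qed

text \<open>The second indicator: for \<open>y^2 = 8 * k + 1\<close>, the equation holds exactly if
  \<open>n = 12 * k + 1\<close>, and the 1 is the factor \<open>fps_X\<close>.\<close>

lemma psi_nth_twelfth:
  "(fps_X * (psi oo fps_X ^ 12)) $ n = of_bool (\<exists>y>0. odd y \<and> 3 * y\<^sup>2 = 2 * int n + 1)"
proof (cases "\<exists>k. n = 12 * k + 1")
  case True
  then obtain k where k: "n = 12 * k + 1" by blast
  then have "3 * y\<^sup>2 = 2 * int n + 1 \<longleftrightarrow> y\<^sup>2 = 8 * int k + 1" for y by auto
  then show ?thesis
    using k odd_square_iff[of k] by (simp add: fps_nth_compose_X_power psi_def)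
next
  case False
  have "3 * y\<^sup>2 \<noteq> 2 * int n + 1" if oy: "odd y" for y
  proof
    assume y: "3 * y\<^sup>2 = 2 * int n + 1"
    obtain k where "y\<^sup>2 = 8 * int k + 1" using oy by (rule odd_square_mod_8)
    then have "n = 12 * k + 1" using y by linarith
    then show False using False by blast
  qed
  moreover have "(fps_X * (psi oo fps_X ^ 12)) $ n = 0"
  proof (cases n)
    case (Suc l)
    then have "\<not> 12 dvd l" using False by auto
    then show ?thesis using Suc by (simp add: fps_nth_compose_X_power)
  qed simp
  ultimately show ?thesis by auto
qed

lemma psi_mult_dissection:
  "psi * (psi oo fps_X ^ 3) = (psi oo fps_X ^ 4) + fps_X * (psi oo fps_X ^ 12)"
proof (rule fps_ext)
  fix n :: nat
  let ?I = "{i. i \<le> n \<and> (\<exists>x. x\<^sup>2 = 8 * i + 1) \<and> 3 dvd n - i \<and> (\<exists>y. y\<^sup>2 = 8 * ((n - i) div 3) + 1)}"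
  have "(psi * (psi oo fps_X ^ 3)) $ n = (\<Sum>i\<in>{0..n}. if i \<in> ?I then 1 else 0)"
    unfolding fps_mult_nth fps_nth_compose_X_power psi_def by (intro sum.cong) auto
  also have "\<dots> = (\<Sum>i\<in>?I. 1)"
  proof -
    have "{0..n} \<inter> ?I = ?I" by auto
    then show ?thesis by (simp only: sum.inter_restrict[symmetric] finite_atLeastAtMost)
  qed
  also have "\<dots> = (\<Sum>p\<in>odd_reps (4 * (2 * int n + 1)). 1)"
    using sum.reindex_bij_betw[OF bij_betw_odd_reps[of n], of "\<lambda>_. 1 :: bit"] by simp
  also have "\<dots> = ((psi oo fps_X ^ 4) + fps_X * (psi oo fps_X ^ 12)) $ n"
    unfolding sum_odd_reps fps_add_nth psi_nth_quarter psi_nth_twelfth ..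
  finally show "(psi * (psi oo fps_X ^ 3)) $ n = ((psi oo fps_X ^ 4) + fps_X * (psi oo fps_X ^ 12)) $ n" .
qed

subsection \<open>Sections of $1/(\psi_1\psi_3)$ modulo 2\<close>

definition fps_section :: "nat \<Rightarrow> nat \<Rightarrow> 'a::comm_ring_1 fps \<Rightarrow> 'a fps" where
  "fps_section k r F = Abs_fps (\<lambda>n. F $ (k * n + r))"

lemma fps_section_nth [simp]: "fps_section k r F $ n = F $ (k * n + r)"
  by (simp add: fps_section_def)

text \<open>Multiplying by a series in \<open>fps_X ^ k\<close> mixes coefficients only within
  residue classes modulo \<open>k\<close>, so that series can be taken out of the section.\<close>

lemma fps_section_mult:
  assumes "r < k"
  shows "fps_section k r (F * (G oo fps_X ^ k)) = fps_section k r F * G"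
proof (rule fps_ext)
  fix n
  let ?h = "\<lambda>i. (G oo fps_X ^ k) $ i * F $ (k * n + r - i)"
  have k: "k > 0" using assms by simp
  have "fps_section k r (F * (G oo fps_X ^ k)) $ n = (\<Sum>i\<in>{0..k*n+r}. ?h i)"
    by (simp only: fps_section_nth mult.commute[of F] fps_mult_nth)
  also have "\<dots> = (\<Sum>i\<in>(\<lambda>t. k * t) ` {0..n}. ?h i)"
  proof (rule sum.mono_neutral_right)
    show "(\<lambda>t. k * t) ` {0..n} \<subseteq> {0..k*n+r}"
      by (auto intro!: trans_le_add1)
    show "\<forall>i\<in>{0..k*n+r} - (\<lambda>t. k * t) ` {0..n}. ?h i = 0"
    proof
      fix i assume i: "i \<in> {0..k*n+r} - (\<lambda>t. k * t) ` {0..n}"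
      have "\<not> k dvd i"
      proof
        assume "k dvd i"
        then obtain t where t: "i = k * t" by blast
        have "k * t < k * (n + 1)" using i assms t by (simp add: less_le_trans)
        then have "t < n + 1" using mult_less_cancel1 by blast
        then have "t \<le> n" by simp
        then show False using i t by auto
      qed
      then show "?h i = 0" by (simp add: fps_nth_compose_X_power)
    qed
  qed simp
  also have "\<dots> = (\<Sum>t\<in>{0..n}. ?h (k * t))"
    by (subst sum.reindex) (use k in \<open>auto simp: inj_on_def\<close>)
  also have "\<dots> = (\<Sum>t\<in>{0..n}. G $ t * fps_section k r F $ (n - t))"
  proof (rule sum.cong)
    fix t assume "t \<in> {0..n}"
    then have "k * n + r - k * t = k * (n - t) + r"
      by (simp add: diff_mult_distrib2)
    then show "?h (k * t) = G $ t * fps_section k r F $ (n - t)"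
      using k by (simp add: fps_nth_compose_X_power)
  qed simp
  also have "\<dots> = (fps_section k r F * G) $ n"
    by (simp only: mult.commute[of _ G] fps_mult_nth)
  finally show "fps_section k r (F * (G oo fps_X ^ k)) $ n = (fps_section k r F * G) $ n" .
qed

lemma fps_compose_X_power_X_power:
  fixes F :: "'a::idom fps"
  assumes "k > 0" "l > 0"
  shows "(F oo fps_X ^ k) oo fps_X ^ l = F oo fps_X ^ (k * l)"
proof (rule fps_ext)
  fix n
  have "l dvd n \<and> k dvd n div l \<longleftrightarrow> k * l dvd n"
    using assms by (metis dvd_div_iff_mult dvd_mult_right less_numeral_extra(3))
  moreover have "n div l div k = n div (k * l)" by (simp add: div_mult2_eq mult.commute[of k])
  ultimately show "((F oo fps_X ^ k) oo fps_X ^ l) $ n = (F oo fps_X ^ (k * l)) $ n"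
    by (auto simp: fps_nth_compose_X_power)
qed

lemma fps_section_compose_0:
  assumes "k > 0" "k dvd l"
  shows "fps_section k 0 (F oo fps_X ^ l) = F oo fps_X ^ (l div k)"
proof (rule fps_ext)
  fix n
  obtain d where d: "l = k * d" using assms(2) by blast
  show "fps_section k 0 (F oo fps_X ^ l) $ n = (F oo fps_X ^ (l div k)) $ n"
    using assms(1) by (simp add: d fps_nth_compose_X_power)
qed

text \<open>This is \<open>psi\<close> at \<open>q^k\<close>, written psi_k in the overview, and not
  a power of \<open>psi\<close>.\<close>

abbreviation psi_pow :: "nat \<Rightarrow> bit fps" where
  "psi_pow k \<equiv> psi oo fps_X ^ k"

lemma psi_nth_0 [simp]: "psi $ 0 = 1"
  by (auto simp: psi_def intro!: exI[of _ 1])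

lemma psi_pow_nth_0 [simp]: "psi_pow k $ 0 = 1"
  by (simp add: psi_nth_0)

lemma psi_pow_double:
  assumes "k > 0"
  shows "psi_pow (2 * k) = psi_pow k * psi_pow k"
proof -
  have "psi_pow (2 * k) = psi_pow k oo fps_X ^ 2"
    using assms by (simp only: fps_compose_X_power_X_power mult.commute[of k] zero_less_numeral)
  also have "\<dots> = psi_pow k * psi_pow k"
    using fps_bit_power2[of "psi_pow k"] unfolding power2_eq_square[of "psi_pow k"] by (rule sym)
  finally show ?thesis .
qed

lemma inverse_compose_X_power:
  fixes F :: "'a::field fps"
  assumes "F $ 0 \<noteq> 0" "k > 0"
  shows "inverse F oo fps_X ^ k = inverse (F oo fps_X ^ k)"
  using assms by (intro fps_inverse_compose) simp_all

text \<open>In the dissection, \<open>psi_pow 4\<close> has only even exponents and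
  \<open>fps_X * psi_pow 12\<close> only odd ones, so each section keeps one summand.\<close>

lemma section_psi_1_3:
  "fps_section 2 0 (psi_pow 1 * psi_pow 3) = psi_pow 2"
  "fps_section 2 1 (psi_pow 1 * psi_pow 3) = psi_pow 6"
proof -
  have e: "psi_pow 1 * psi_pow 3 = psi_pow 4 + fps_X * psi_pow 12"
    using psi_mult_dissection by simp
  have d: "\<not> 4 dvd Suc (2 * n)" "n \<noteq> 0 \<Longrightarrow> \<not> 12 dvd 2 * n - Suc 0" "12 dvd 2 * n \<longleftrightarrow> 6 dvd n"
    "2 * n div 12 = n div 6" for n :: nat
    by presburger+
  have "fps_section 2 0 (fps_X * psi_pow 12) = 0" "fps_section 2 1 (fps_X * psi_pow 12) = psi_pow 6"
    "fps_section 2 1 (psi_pow 4) = 0"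
    by (simp_all add: fps_eq_iff fps_nth_compose_X_power d)
  moreover have "fps_section 2 0 (psi_pow 4) = psi_pow 2"
    using fps_section_compose_0[of 2 4 psi] by simp
  moreover have "fps_section 2 r (F + G) = fps_section 2 r F + fps_section 2 r G" for r and F G :: "bit fps"
    by (simp add: fps_eq_iff)
  ultimately show "fps_section 2 0 (psi_pow 1 * psi_pow 3) = psi_pow 2"
    "fps_section 2 1 (psi_pow 1 * psi_pow 3) = psi_pow 6"
    unfolding e by simp_all
qed

text \<open>If \<open>8 * (3 * n + 1) + 1 = 3 * (8 * n + 3)\<close> is a square, then 9 divides it
  and so \<open>3 dvd n\<close>. For \<open>n = 3 * k\<close> it is
  \<open>9 * (8 * k + 1)\<close>.\<close>

lemma section_psi_3: "fps_section 3 1 (psi_pow 1) = psi_pow 3"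
proof (rule fps_ext)
  fix n
  show "fps_section 3 1 (psi_pow 1) $ n = psi_pow 3 $ n"
  proof (cases "3 dvd n")
    case True
    then obtain k where k: "n = 3 * k" by blast
    have "(\<exists>x. x\<^sup>2 = 8 * (3 * n + 1) + 1) \<longleftrightarrow> (\<exists>x. x\<^sup>2 = 8 * k + 1)"
    proof
      assume "\<exists>x. x\<^sup>2 = 8 * (3 * n + 1) + 1"
      then obtain x where x: "x\<^sup>2 = 9 * (8 * k + 1)" unfolding k by auto
      then have "3 dvd x\<^sup>2" by simp
      then have "3 dvd x" using prime_dvd_power[of 3 x 2] by simp
      then obtain z where "x = 3 * z" by blast
      then have "z\<^sup>2 = 8 * k + 1" using x by (simp add: power_mult_distrib)
      then show "\<exists>x. x\<^sup>2 = 8 * k + 1" by blast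
    next
      assume "\<exists>x. x\<^sup>2 = 8 * k + 1"
      then obtain x where "x\<^sup>2 = 8 * k + 1" by blast
      then have "(3 * x)\<^sup>2 = 8 * (3 * n + 1) + 1" unfolding k by (simp add: power_mult_distrib)
      then show "\<exists>x. x\<^sup>2 = 8 * (3 * n + 1) + 1" by blast
    qed
    then show ?thesis using k by (simp add: fps_nth_compose_X_power psi_def)
  next
    case False
    have "x\<^sup>2 \<noteq> 8 * (3 * n + 1) + 1" for x
    proof
      assume x: "x\<^sup>2 = 8 * (3 * n + 1) + 1"
      then have "x\<^sup>2 = 3 * (8 * n + 3)" by simp
      then have "3 dvd x\<^sup>2" by simp
      then have "3 dvd x" using prime_dvd_power[of 3 x 2] by simp
      then obtain z where "x = 3 * z" by blast
      then have "9 * z\<^sup>2 = 8 * (3 * n + 1) + 1" using x by (simp add: power_mult_distrib)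
      then have "3 dvd n" by presburger
      then show False using False by simp
    qed
    then show ?thesis using False by (simp add: fps_nth_compose_X_power psi_def)
  qed
qed

lemma mult_inverse_eq_fps:
  fixes F G H :: "'a::field fps"
  assumes "G $ 0 \<noteq> 0" "H $ 0 \<noteq> 0" "F * H = K * G"
  shows "F * inverse G = K * inverse H"
proof -
  have "(F * inverse G) * (G * H) = (K * inverse H) * (G * H)"
    using inverse_mult_eq_1[OF assms(1)] inverse_mult_eq_1[OF assms(2)] assms(3)
    by (metis (no_types, lifting) mult.assoc mult.commute mult_1_right)
  moreover have "G * H \<noteq> 0" using assms(1,2) by auto
  ultimately show ?thesis by (metis mult_right_cancel)
qed

text \<open>Modulo 2, \<open>G^2\<close> is \<open>G\<close> at \<open>q^2\<close>, so its inverse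
  is a series in \<open>fps_X ^ 2\<close> and leaves the section as
  \<open>inverse G\<close>.\<close>

lemma section_2_inverse:
  fixes G :: "bit fps"
  assumes "r < 2" "G $ 0 = 1"
  shows "fps_section 2 r (F * inverse (G\<^sup>2)) = fps_section 2 r F * inverse G"
proof -
  have "inverse (G\<^sup>2) = inverse G oo fps_X ^ 2"
    using assms(2) by (simp add: fps_bit_power2[of G] inverse_compose_X_power)
  then show ?thesis using assms(1) by (simp add: fps_section_mult)
qed

definition G13 :: "bit fps" where
  "G13 = inverse (psi_pow 1 * psi_pow 3)"

text \<open>Expanding the fraction makes the denominator a square, ready for
  \<open>section_2_inverse\<close>, and the numerator the product whose sections are known.\<close>

lemma G13_eq: "G13 = psi_pow 1 * psi_pow 3 * inverse ((psi_pow 1 * psi_pow 3)\<^sup>2)"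
proof -
  have "1 * inverse (psi_pow 1 * psi_pow 3) = psi_pow 1 * psi_pow 3 * inverse ((psi_pow 1 * psi_pow 3)\<^sup>2)"
    by (rule mult_inverse_eq_fps) (simp_all add: power2_eq_square)
  then show ?thesis by (simp add: G13_def)
qed

text \<open>Expanding by \<open>psi_pow 1\<close> gives the even section
  \<open>psi_pow 2 * inverse (psi_pow 1)\<close>, and \<open>psi_pow 2\<close> is the square of
  \<open>psi_pow 1\<close>.\<close>

lemma section_psi_ratio: "fps_section 2 0 (psi_pow 3 * inverse (psi_pow 1)) = psi_pow 1"
proof -
  have "psi_pow 3 * inverse (psi_pow 1) = psi_pow 1 * psi_pow 3 * inverse ((psi_pow 1)\<^sup>2)"
    by (rule mult_inverse_eq_fps) (simp_all add: power2_eq_square mult_ac)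
  then have "fps_section 2 0 (psi_pow 3 * inverse (psi_pow 1)) = psi_pow 2 * inverse (psi_pow 1)"
    by (simp only: section_2_inverse psi_pow_nth_0 section_psi_1_3 zero_less_numeral)
  also have "\<dots> = psi_pow 1 * inverse 1"
    using psi_pow_double[of 1] by (intro mult_inverse_eq_fps) simp_all
  finally show ?thesis by simp
qed

text \<open>The sections have numerators \<open>psi_pow 6\<close> and \<open>psi_pow 2\<close> over
  \<open>psi_pow 1 * psi_pow 3\<close>. These are the squares of \<open>psi_pow 3\<close> and
  \<open>psi_pow 1\<close>, so one factor cancels.\<close>

lemma section_G13:
  "fps_section 2 1 G13 = psi_pow 3 * inverse (psi_pow 1)"
  "fps_section 2 0 G13 = psi_pow 1 * inverse (psi_pow 3)"
proof -
  have "fps_section 2 1 G13 = psi_pow 6 * inverse (psi_pow 1 * psi_pow 3)"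
    unfolding G13_eq by (subst section_2_inverse) (simp_all only: section_psi_1_3, simp_all)
  also have "\<dots> = psi_pow 3 * inverse (psi_pow 1)"
    using psi_pow_double[of 3] by (intro mult_inverse_eq_fps) (simp_all add: mult_ac)
  finally show "fps_section 2 1 G13 = psi_pow 3 * inverse (psi_pow 1)" .
  have "fps_section 2 0 G13 = psi_pow 2 * inverse (psi_pow 1 * psi_pow 3)"
    unfolding G13_eq by (subst section_2_inverse) (simp_all only: section_psi_1_3, simp_all)
  also have "\<dots> = psi_pow 1 * inverse (psi_pow 3)"
    using psi_pow_double[of 1] by (intro mult_inverse_eq_fps) (simp_all add: mult_ac)
  finally show "fps_section 2 0 G13 = psi_pow 1 * inverse (psi_pow 3)" .
qed

text \<open>As \<open>inverse (psi_pow 3)\<close> is a series in \<open>fps_X ^ 3\<close>, only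
  \<open>psi_pow 1\<close> is dissected. The result is the odd section of \<open>G13\<close>, so
  both progressions end in \<open>section_psi_ratio\<close>.\<close>

lemma section_3_G13: "fps_section 3 1 (psi_pow 1 * inverse (psi_pow 3)) = psi_pow 3 * inverse (psi_pow 1)"
proof -
  have "inverse (psi_pow 3) = inverse (psi_pow 1) oo fps_X ^ 3"
    using inverse_compose_X_power[of psi 3] by (simp add: psi_nth_0)
  then show ?thesis using fps_section_mult[of 1 3 "psi_pow 1" "inverse (psi_pow 1)"]
    by (simp only: section_psi_3)
qed

lemma G13_nth: "G13 $ (4 * n + 1) = psi $ n" "G13 $ (12 * n + 2) = psi $ n"
proof -
  \<comment> \<open>The indices compose to \<open>2 * (2 * n) + 1 = 4 * n + 1\<close>.\<close>
  have "fps_section 2 0 (fps_section 2 1 G13) = psi"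
    by (simp only: section_G13 section_psi_ratio) simp
  then have "fps_section 2 0 (fps_section 2 1 G13) $ n = psi $ n" by simp
  then show "G13 $ (4 * n + 1) = psi $ n" by simp
  \<comment> \<open>The indices compose to
    \<open>2 * (3 * (2 * n) + 1) = 12 * n + 2\<close>.\<close>
  have "fps_section 2 0 (fps_section 3 1 (fps_section 2 0 G13)) = psi"
    by (simp only: section_G13 section_3_G13 section_psi_ratio) simp
  then have "fps_section 2 0 (fps_section 3 1 (fps_section 2 0 G13)) $ n = psi $ n" by simp
  then show "G13 $ (12 * n + 2) = psi $ n" by simp
qed

subsection \<open>Reduction modulo 2 of the Hauptmodul\<close>

text \<open>A relation and not a map, since only integral series can be reduced: one integer per
  coefficient witnesses both integrality and the residue.\<close>

definition reduces_mod_2 :: "rat fps \<Rightarrow> bit fps \<Rightarrow> bool" where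
  "reduces_mod_2 F G \<longleftrightarrow> (\<forall>n. \<exists>k. F $ n = of_int k \<and> G $ n = of_int k)"

lemma reduces_mod_2I:
  assumes "\<And>n. F $ n = of_int (f n)" "\<And>n. G $ n = of_int (f n)"
  shows "reduces_mod_2 F G"
  using assms unfolding reduces_mod_2_def by blast

lemma reduces_mod_2E:
  assumes "reduces_mod_2 F G"
  obtains f where "\<And>n. F $ n = of_int (f n)" "\<And>n. G $ n = of_int (f n)"
  using assms unfolding reduces_mod_2_def by metis

lemma reduces_mod_2_numeral: "reduces_mod_2 (numeral w) (numeral w)"
  by (rule reduces_mod_2I[where f = "\<lambda>n. if n = 0 then numeral w else 0"])
     (simp_all add: numeral_fps_const)

lemma reduces_mod_2_1: "reduces_mod_2 1 1"
  by (rule reduces_mod_2I[where f = "\<lambda>n. if n = 0 then 1 else 0"]) simp_all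

lemma reduces_mod_2_X: "reduces_mod_2 fps_X fps_X"
  by (rule reduces_mod_2I[where f = "\<lambda>n. if n = 1 then 1 else 0"]) simp_all

lemma reduces_mod_2_add:
  assumes "reduces_mod_2 F G" "reduces_mod_2 F' G'"
  shows "reduces_mod_2 (F + F') (G + G')"
  using assms by (elim reduces_mod_2E) (rule reduces_mod_2I, simp_all flip: of_int_add)

lemma reduces_mod_2_diff:
  assumes "reduces_mod_2 F G" "reduces_mod_2 F' G'"
  shows "reduces_mod_2 (F - F') (G - G')"
  using assms by (elim reduces_mod_2E) (rule reduces_mod_2I, simp_all flip: of_int_diff)

lemma reduces_mod_2_mult:
  assumes "reduces_mod_2 F G" "reduces_mod_2 F' G'"
  shows "reduces_mod_2 (F * F') (G * G')"
  using assms
  by (elim reduces_mod_2E) (rule reduces_mod_2I, simp_all add: fps_mult_nth flip: of_int_mult of_int_sum)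

lemma reduces_mod_2_power:
  assumes "reduces_mod_2 F G"
  shows "reduces_mod_2 (F ^ n) (G ^ n)"
  by (induction n) (simp_all add: reduces_mod_2_1 reduces_mod_2_mult assms)

lemma reduces_mod_2_prod:
  assumes "\<And>i. i \<in> A \<Longrightarrow> reduces_mod_2 (F i) (G i)"
  shows "reduces_mod_2 (\<Prod>i\<in>A. F i) (\<Prod>i\<in>A. G i)"
  using assms
  by (induction A rule: infinite_finite_induct) (simp_all add: reduces_mod_2_1 reduces_mod_2_mult)

lemma inverse_fps_nth_rec:
  fixes F :: "'a::field fps"
  assumes "F $ 0 = 1" "n > 0"
  shows "inverse F $ n = - (\<Sum>i\<in>{1..n}. F $ i * inverse F $ (n - i))"
proof -
  have "F * inverse F = 1" using assms(1) by (simp add: inverse_mult_eq_1')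
  then have "(\<Sum>i\<in>{0..n}. F $ i * inverse F $ (n - i)) = 0"
    using assms(2) by (simp flip: fps_mult_nth)
  then have "inverse F $ n + (\<Sum>i\<in>{1..n}. F $ i * inverse F $ (n - i)) = 0"
    using assms(1) by (simp add: sum.atLeast_Suc_atMost)
  then show ?thesis by (simp only: eq_neg_iff_add_eq_0)
qed

text \<open>With constant term 1 the recursion for the inverse involves no division, so strong
  induction yields integers that serve on both sides.\<close>

lemma reduces_mod_2_inverse:
  assumes "reduces_mod_2 F G" "F $ 0 = 1"
  shows "reduces_mod_2 (inverse F) (inverse G)"
proof -
  obtain f where f: "\<And>n. F $ n = of_int (f n)" "\<And>n. G $ n = of_int (f n)"
    using assms(1) by (rule reduces_mod_2E) blast
  have "f 0 = 1" using f(1)[of 0] assms(2) by simp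
  then have G0: "G $ 0 = 1" using f(2)[of 0] by simp
  have "\<exists>k. inverse F $ n = of_int k \<and> inverse G $ n = of_int k" for n
  proof (induction n rule: less_induct)
    case (less n)
    show ?case
    proof (cases "n = 0")
      case True
      then show ?thesis using assms(2) G0 by (intro exI[of _ 1]) simp
    next
      case False
      obtain g where g: "\<And>j. j < n \<Longrightarrow> inverse F $ j = of_int (g j) \<and> inverse G $ j = of_int (g j)"
        using less by metis
      have "inverse F $ n = of_int (- (\<Sum>i\<in>{1..n}. f i * g (n - i)))"
        using False assms(2) by (simp add: inverse_fps_nth_rec f g)
      moreover have "inverse G $ n = of_int (- (\<Sum>i\<in>{1..n}. f i * g (n - i)))"
        using False G0 by (simp add: inverse_fps_nth_rec f g)
      ultimately show ?thesis by blast
    qed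
  qed
  then show ?thesis by (simp add: reduces_mod_2_def)
qed

lemma qpoch_fps_eq: "qpoch_fps k = euler_fps k"
  by (simp add: qpoch_fps_def euler_fps_def)

lemma reduces_mod_2_euler: "reduces_mod_2 (euler_fps k) (euler_fps k)"
proof -
  have "reduces_mod_2 (\<Prod>j\<in>{1..n}. 1 - fps_X ^ (k * j)) (\<Prod>j\<in>{1..n}. 1 - fps_X ^ (k * j))" for n
    by (intro reduces_mod_2_prod reduces_mod_2_diff reduces_mod_2_1 reduces_mod_2_power reduces_mod_2_X)
  then show ?thesis unfolding reduces_mod_2_def euler_fps_def fps_nth_Abs_fps by blast
qed

text \<open>With \<open>c = e 1 * e 3\<close>, squaring modulo 2 gives
  \<open>e 2 * e 6 = c^2\<close>, so \<open>P6\<close> reduces to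
  \<open>c^6 / c^12 = 1 / (c^3)^2\<close>. Here \<open>c^3\<close> is
  \<open>psi * (psi oo fps_X ^ 3)\<close>, and the outer square becomes the substitution of
  \<open>fps_X ^ 2\<close>.\<close>

lemma P6_mod_2: "reduces_mod_2 P6 (G13 oo fps_X ^ 2)"
proof -
  define e :: "nat \<Rightarrow> bit fps" where "e = euler_fps"
  have e0: "e k $ 0 = 1" for k by (simp add: e_def)
  have e1: "e 1 ^ 3 = psi" by (simp add: e_def euler_fps_bit_cube del: One_nat_def)
  have ek: "e k = e 1 oo fps_X ^ k" if "k > 0" for k
    unfolding e_def using that by (rule euler_fps_compose)
  have e3: "e 3 ^ 3 = psi oo fps_X ^ 3"
    using ek[of 3] by (simp add: fps_compose_power e1[symmetric])
  have e2: "e 2 = (e 1)\<^sup>2"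
    unfolding fps_bit_power2[of "e 1"] by (rule ek) simp
  have e6: "e 6 = (e 3)\<^sup>2"
    unfolding fps_bit_power2[of "e 3"] using ek[of 6] ek[of 3] by (simp add: fps_compose_X_power_X_power)
  define c where "c = e 1 * e 3"
  have c0: "c $ 0 = 1" by (simp add: c_def e0)
  have "e 2 * e 6 = c\<^sup>2" by (simp add: c_def e2 e6 power_mult_distrib)
  then have "(e 1 * e 3) ^ 6 * inverse ((e 2 * e 6) ^ 6) = c ^ 6 * inverse ((c\<^sup>2) ^ 6)"
    by (simp add: c_def)
  also have "\<dots> = 1 * inverse ((c ^ 3)\<^sup>2)"
    by (rule mult_inverse_eq_fps) (simp_all add: fps_nth_power_0 c0 flip: power_mult power_add)
  also have "c ^ 3 = (e 1) ^ 3 * (e 3) ^ 3"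
    by (simp add: c_def power_mult_distrib)
  also have "1 * inverse (((e 1) ^ 3 * (e 3) ^ 3)\<^sup>2) = inverse ((psi * (psi oo fps_X ^ 3))\<^sup>2)"
    unfolding e1 e3 by simp
  also have "\<dots> = inverse (psi * (psi oo fps_X ^ 3)) oo fps_X ^ 2"
    by (simp add: fps_bit_power2[of "psi * (psi oo fps_X ^ 3)"] inverse_compose_X_power)
  also have "\<dots> = G13 oo fps_X ^ 2"
    by (simp add: G13_def)
  finally have e: "(e 1 * e 3) ^ 6 * inverse ((e 2 * e 6) ^ 6) = G13 oo fps_X ^ 2" .
  show ?thesis
    unfolding P6_def qpoch_fps_eq e[symmetric] unfolding e_def
    by (intro reduces_mod_2_mult reduces_mod_2_power reduces_mod_2_inverse reduces_mod_2_euler)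
       (simp add: fps_nth_power_0)
qed

lemma of_int_bit_eq_0_iff: "(of_int k :: bit) = 0 \<longleftrightarrow> even k"
proof
  assume "(of_int k :: bit) = 0"
  then show "even k" by (cases "even k") (auto elim!: oddE)
qed (auto elim!: evenE)

lemma Jstar6_even:
  assumes "G13 $ l = 0" "n + 1 = 2 * l"
  shows "Jstar6 n / 2 \<in> \<int>"
proof -
  \<comment> \<open>Constant term 1 makes \<open>inverse P6\<close> integral, so the term with
    factor 64 vanishes modulo 2.\<close>
  have P0: "P6 $ 0 = 1"
    by (simp add: P6_def qpoch_fps_eq fps_nth_power_0)
  have "reduces_mod_2 (P6 + 6 * fps_X + 64 * fps_X ^ 2 * inverse P6)
      ((G13 oo fps_X ^ 2) + 6 * fps_X + 64 * fps_X ^ 2 * inverse (G13 oo fps_X ^ 2))"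
    by (intro reduces_mod_2_add reduces_mod_2_mult reduces_mod_2_power reduces_mod_2_inverse
        reduces_mod_2_numeral reduces_mod_2_X P6_mod_2 P0)
  moreover have "(6 :: bit fps) = 0" "(64 :: bit fps) = 0"
    by (simp_all add: numeral_fps_const)
  ultimately have "reduces_mod_2 (P6 + 6 * fps_X + 64 * fps_X ^ 2 * inverse P6) (G13 oo fps_X ^ 2)"
    by simp
  then obtain k where k: "Jstar6 n = of_int k" "(G13 oo fps_X ^ 2) $ (n + 1) = of_int k"
    unfolding reduces_mod_2_def Jstar6_def by blast
  have "(G13 oo fps_X ^ 2) $ (n + 1) = 0"
    unfolding assms(2) using assms(1) by (simp add: fps_nth_compose_X_power)
  then have "(of_int k :: bit) = 0" using k(2) by simp
  then have "even k" by (simp only: of_int_bit_eq_0_iff)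
  then show ?thesis using k(1) by (auto elim!: evenE)
qed

text \<open>Raising the index by 1 for the pole \<open>1/q\<close> gives
  \<open>8 * n + 2 = 2 * (4 * n + 1)\<close> and \<open>24 * n + 4 = 2 * (12 * n + 2)\<close>, the
  doubled progressions of \<open>G13_nth\<close>.\<close>

lemma Jstar6_even_of_nonsquare:
  assumes "m \<in> {0, 1}" "\<nexists>x. x\<^sup>2 = 8 * n + 1"
  shows "Jstar6 (3 ^ m * (8 * n + 1)) / 2 \<in> \<int>"
proof -
  have psi: "psi $ n = 0" using assms(2) by (simp add: psi_def)
  consider "m = 0" | "m = 1" using assms(1) by blast
  then show ?thesis
  proof cases
    case 1
    then show ?thesis using G13_nth(1)[of n] psi by (intro Jstar6_even[of "4 * n + 1"]) simp_all
  next
    case 2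
    then show ?thesis using G13_nth(2)[of n] psi by (intro Jstar6_even[of "12 * n + 2"]) simp_all
  qed
qed

subsection \<open>Density\<close>

text \<open>The root \<open>x\<close> determines \<open>n\<close> and is at most
  \<open>sqrt (8 * X + 1)\<close>. The additional 1 comes from \<open>x = 0\<close> in the range of
  roots.\<close>

lemma card_squares_le:
  fixes X :: real
  assumes "X \<ge> 0"
  shows "real (card {n. real n \<le> X \<and> (\<exists>x. x\<^sup>2 = 8 * n + 1)}) \<le> sqrt (8 * X + 1) + 1"
proof -
  let ?N = "nat \<lfloor>sqrt (8 * X + 1)\<rfloor>"
  have "{n. real n \<le> X \<and> (\<exists>x. x\<^sup>2 = 8 * n + 1)} \<subseteq> (\<lambda>x. (x\<^sup>2 - 1) div 8) ` {..?N}"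
  proof
    fix n assume "n \<in> {n. real n \<le> X \<and> (\<exists>x. x\<^sup>2 = 8 * n + 1)}"
    then obtain x where x: "real n \<le> X" "x\<^sup>2 = 8 * n + 1" by blast
    have "(real x)\<^sup>2 = 8 * real n + 1" using arg_cong[OF x(2), of real] by simp
    then have "real x \<le> sqrt (8 * X + 1)" using x(1) by (intro real_le_rsqrt) simp
    then have "x \<le> ?N" by (simp add: le_nat_floor)
    moreover have "n = (x\<^sup>2 - 1) div 8" using x(2) by simp
    ultimately show "n \<in> (\<lambda>x. (x\<^sup>2 - 1) div 8) ` {..?N}" by blast
  qed
  then have "card {n. real n \<le> X \<and> (\<exists>x. x\<^sup>2 = 8 * n + 1)} \<le> card {..?N}"
    by (meson card_image_le card_mono finite_atMost finite_imageI le_trans)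
  also have "\<dots> = ?N + 1" by simp
  finally have "real (card {n. real n \<le> X \<and> (\<exists>x. x\<^sup>2 = 8 * n + 1)}) \<le> real (?N + 1)"
    by (simp only: of_nat_le_iff)
  also have "real (?N + 1) \<le> sqrt (8 * X + 1) + 1"
    using assms by simp
  finally show ?thesis .
qed

text \<open>The count is at most \<open>X + 1\<close> and at least \<open>X\<close> minus the bound
  of \<open>card_squares_le\<close>. Both bounds divided by \<open>X\<close> tend to 1.\<close>

lemma density_one_off_squares:
  assumes "\<And>n. (\<nexists>x. x\<^sup>2 = 8 * n + 1) \<Longrightarrow> Q n"
  shows "((\<lambda>X::real. real (card {n. real n \<le> X \<and> Q n}) / X) \<longlongrightarrow> 1) at_top"
proof (rule tendsto_sandwich)
  have S: "{n. real n \<le> X} = {..nat \<lfloor>X\<rfloor>}" if "X \<ge> 0" for X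
    using that by (auto simp: le_nat_floor le_nat_iff le_floor_iff)
  have upper: "real (card {n. real n \<le> X \<and> Q n}) \<le> X + 1" if "X \<ge> 0" for X
  proof -
    have "card {n. real n \<le> X \<and> Q n} \<le> card {n. real n \<le> X}"
      by (intro card_mono) (simp add: S[OF that], blast)
    also have "\<dots> = nat \<lfloor>X\<rfloor> + 1" by (simp add: S[OF that])
    finally have "real (card {n. real n \<le> X \<and> Q n}) \<le> real (nat \<lfloor>X\<rfloor> + 1)"
      by (simp only: of_nat_le_iff)
    also have "\<dots> \<le> X + 1" using that by simp
    finally show ?thesis .
  qed
  have lower: "X - sqrt (8 * X + 1) - 1 \<le> real (card {n. real n \<le> X \<and> Q n})" if "X \<ge> 0" for X
  proof -
    let ?B = "{n. real n \<le> X \<and> (\<exists>x. x\<^sup>2 = 8 * n + 1)}"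
    have fin: "finite {n. real n \<le> X}" by (simp add: S[OF that])
    have "card {n. real n \<le> X} \<le> card ({n. real n \<le> X \<and> Q n} \<union> ?B)"
      using assms fin by (intro card_mono) auto
    also have "\<dots> \<le> card {n. real n \<le> X \<and> Q n} + card ?B"
      by (rule card_Un_le)
    finally have "real (nat \<lfloor>X\<rfloor> + 1) \<le> real (card {n. real n \<le> X \<and> Q n} + card ?B)"
      unfolding S[OF that] card_atMost of_nat_le_iff by simp
    moreover have "X \<le> real (nat \<lfloor>X\<rfloor> + 1)" using that by linarith
    ultimately show ?thesis using card_squares_le[OF that] by simp
  qed
  show "\<forall>\<^sub>F X in at_top. (X - sqrt (8 * X + 1) - 1) / X \<le> real (card {n. real n \<le> X \<and> Q n}) / X"
    using eventually_gt_at_top[of 0] by eventually_elim (intro divide_right_mono lower; simp)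
  show "\<forall>\<^sub>F X in at_top. real (card {n. real n \<le> X \<and> Q n}) / X \<le> (X + 1) / X"
    using eventually_gt_at_top[of 0] by eventually_elim (intro divide_right_mono upper; simp)
  show "((\<lambda>X::real. (X - sqrt (8 * X + 1) - 1) / X) \<longlongrightarrow> 1) at_top"
    by real_asymp
  show "((\<lambda>X::real. (X + 1) / X) \<longlongrightarrow> 1) at_top"
    by real_asymp
qed

theorem theorem1p1:
  fixes m :: nat
  assumes "m \<in> {0, 1}"
  shows "((\<lambda>X::real. real (card {n::nat. real n \<le> X \<and> Jstar6 (3 ^ m * (8 * n + 1)) / 2 \<in> \<int>}) / X)
           \<longlongrightarrow> 1) at_top"
  using Jstar6_even_of_nonsquare[OF assms] by (rule density_one_off_squares)

end
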